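(* Let $\mathbf{k}$ be a field of characteristic $0$, let $(A,\mu)$ be a power associative algebra over $\mathbf{k}$, and let $\beta\colon A\to A$ be an algebra morphism. Then $A_\beta=(A,\mu_\beta=\beta\mu,\beta)$ is a multiplicative Hom-power associative algebra.
   Context: An algebra $(A,\mu)$ is a $\mathbf{k}$-vector space with a bilinear multiplication $\mu$ (no associativity or unit assumed); an algebra morphism is a linear map $\beta$ with $\beta\mu=\mu\beta^{\otimes 2}$. With right powers $x^1=x$, $x^{n}=\mu(x^{n-1},x)$ for $n\ge2$, the algebra is power associative if $x^n=\mu(x^i,x^{n-i})$ for all $x\in A$, $n\ge 2$ and $i\in\{1,\dots,n-1\}$. A Hom-algebra $(A,\mu,\alpha)$ is a $\mathbf{k}$-vector space $A$ with a bilinear map $\mu\colon A^{\otimes 2}\to A$ and a linear map $\alpha\colon A\to A$; it is multiplicative if $\alpha\mu=\mu\alpha^{\otimes 2}$. Its Hom-powers are $x^1=x$ and $x^n=\mu(x^{n-1},\alpha^{n-2}(x))$ for $n\ge 2$ ($\alpha^n$ the $n$-fold composition, $\alpha^0=Id$). It is Hom-power associative if $x^n=\mu(\alpha^{n-i-1}(x^i),\alpha^{i-1}(x^{n-i}))$ for all $x\in A$, $n\ge 2$ and $i\in\{1,\dots,n-1\}$. *)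

theory Defs
  imports Complex_Main
begin

text \<open>
  Vector spaces are in the style of \<^locale>\<open>vector_space\<close>: the carrier is a type and the scalar
  multiplication is an explicit parameter. An algebra is neither associative nor unital here.
\<close>

locale nonassoc_algebra = vector_space scale
  for scale :: "'k::field \<Rightarrow> 'a::ab_group_add \<Rightarrow> 'a" +
  fixes mult :: "'a \<Rightarrow> 'a \<Rightarrow> 'a"
  assumes linear_mult_left: "Vector_Spaces.linear scale scale (\<lambda>x. mult x y)"
    and linear_mult_right: "Vector_Spaces.linear scale scale (\<lambda>y. mult x y)"

locale algebra_morphism =
  source: nonassoc_algebra scale1 mult1 + target: nonassoc_algebra scale2 mult2
  for scale1 :: "'k::field \<Rightarrow> 'a::ab_group_add \<Rightarrow> 'a" and mult1 :: "'a \<Rightarrow> 'a \<Rightarrow> 'a"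
    and scale2 :: "'k \<Rightarrow> 'b::ab_group_add \<Rightarrow> 'b" and mult2 :: "'b \<Rightarrow> 'b \<Rightarrow> 'b" +
  fixes f :: "'a \<Rightarrow> 'b"
  assumes linear_morphism: "Vector_Spaces.linear scale1 scale2 f"
    and morphism_mult: "f (mult1 x y) = mult2 (f x) (f y)"

text \<open>Powers start at exponent 1; at exponent 0, where there is no equation, both functions below
  are unspecified.\<close>

fun right_power :: "('a \<Rightarrow> 'a \<Rightarrow> 'a) \<Rightarrow> 'a \<Rightarrow> nat \<Rightarrow> 'a" where
  "right_power mult x (Suc 0) = x"
| "right_power mult x (Suc (Suc n)) = mult (right_power mult x (Suc n)) x"

locale power_associative_algebra = nonassoc_algebra +
  assumes power_associative:
    "n \<ge> 2 \<Longrightarrow> i \<in> {1..n - 1} \<Longrightarrow>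
      right_power mult x n = mult (right_power mult x i) (right_power mult x (n - i))"

locale hom_algebra = nonassoc_algebra scale mult
  for scale :: "'k::field \<Rightarrow> 'a::ab_group_add \<Rightarrow> 'a" and mult :: "'a \<Rightarrow> 'a \<Rightarrow> 'a" +
  fixes twist :: "'a \<Rightarrow> 'a"
  assumes linear_twist: "Vector_Spaces.linear scale scale twist"

locale multiplicative_hom_algebra = hom_algebra +
  assumes multiplicative: "twist (mult x y) = mult (twist x) (twist y)"

text \<open>With \<open>m = n + 2\<close>, the second equation is the recursion whose twisting exponent is \<open>m - 2\<close>.\<close>

fun hom_power :: "('a \<Rightarrow> 'a \<Rightarrow> 'a) \<Rightarrow> ('a \<Rightarrow> 'a) \<Rightarrow> 'a \<Rightarrow> nat \<Rightarrow> 'a" where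
  "hom_power mult twist x (Suc 0) = x"
| "hom_power mult twist x (Suc (Suc n)) = mult (hom_power mult twist x (Suc n)) ((twist ^^ n) x)"

locale hom_power_associative_algebra = hom_algebra +
  assumes hom_power_associative:
    "n \<ge> 2 \<Longrightarrow> i \<in> {1..n - 1} \<Longrightarrow>
      hom_power mult twist x n =
        mult ((twist ^^ (n - i - 1)) (hom_power mult twist x i))
             ((twist ^^ (i - 1)) (hom_power mult twist x (n - i)))"

end

theory Submission
  imports Defs
begin

text \<open>
  Twisting by a morphism \<open>\<beta>\<close> turns every product of two elements into its image under \<open>\<beta>\<close>. Since
  each iterate of \<open>\<beta>\<close> is again multiplicative, the twists in a Hom-power can be pulled out of the
  product one after the other, and the \<open>n\<close>-th Hom-power for \<open>\<beta>\<mu>\<close> is \<open>\<beta>\<^sup>n\<^sup>-\<^sup>1\<close> applied to the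
  ordinary \<open>n\<close>-th right power (lemma \<open>hom_power_twisted\<close>). In the Hom-power associativity
  identity the twisting exponents \<open>n - i - 1\<close> and \<open>i - 1\<close> are exactly those that put the same
  iterate \<open>\<beta>\<^sup>n\<^sup>-\<^sup>2\<close> in front of both factors, so the identity is the image under \<open>\<beta>\<^sup>n\<^sup>-\<^sup>1\<close> of
  ordinary power associativity.
\<close>

lemma funpow_morphism_mult:
  assumes "\<And>x y. f (mult x y) = mult (f x) (f y)"
  shows "(f ^^ n) (mult x y) = mult ((f ^^ n) x) ((f ^^ n) y)"
  by (induction n) (simp_all add: assms)

text \<open>
  The exponents of \<open>f\<close> agree in the induction step: the recursion twists the new factor \<open>x\<close> by
  \<open>f\<^sup>n\<close>, the induction hypothesis twists the power built so far by the same \<open>f\<^sup>n\<close>, and the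
  multiplication itself contributes one more \<open>f\<close>.
\<close>

lemma hom_power_twisted:
  assumes "\<And>x y. f (mult x y) = mult (f x) (f y)"
  shows "hom_power (\<lambda>x y. f (mult x y)) f x (Suc n) = (f ^^ n) (right_power mult x (Suc n))"
  by (induction n) (simp_all add: funpow_morphism_mult[of f mult, OF assms])

lemma (in nonassoc_algebra) hom_algebra_twisted:
  assumes "Vector_Spaces.linear scale scale f"
  shows "hom_algebra scale (\<lambda>x y. f (mult x y)) f"
proof (intro hom_algebra.intro nonassoc_algebra.intro nonassoc_algebra_axioms.intro
    hom_algebra_axioms.intro)
  show "vector_space scale" ..
  show "Vector_Spaces.linear scale scale (\<lambda>x. f (mult x y))" for y
    using Vector_Spaces.linear_compose[OF linear_mult_left assms] by (simp add: comp_def)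
  show "Vector_Spaces.linear scale scale (\<lambda>y. f (mult x y))" for x
    using Vector_Spaces.linear_compose[OF linear_mult_right assms] by (simp add: comp_def)
qed (rule assms)

lemma (in power_associative_algebra) hom_power_associative_twisted:
  fixes x
  assumes morphism: "\<And>x y. f (mult x y) = mult (f x) (f y)"
    and "n \<ge> 2" "i \<in> {1..n - 1}"
  defines "P \<equiv> hom_power (\<lambda>x y. f (mult x y)) f x"
  shows "P n = f (mult ((f ^^ (n - i - 1)) (P i)) ((f ^^ (i - 1)) (P (n - i))))"
proof -
  define a b where "a = i - 1" and "b = n - i - 1"
  have i: "i = Suc a" and n_i: "n - i = Suc b" and n: "n = Suc (Suc (a + b))"
    using assms(2,3) by (auto simp: a_def b_def)
  note power = hom_power_twisted[of f mult x, OF morphism, folded P_def]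
  let ?pow = "right_power mult x"
  have "P n = (f ^^ Suc (a + b)) (?pow n)"
    unfolding n by (rule power)
  also have "\<dots> = (f ^^ Suc (a + b)) (mult (?pow (Suc a)) (?pow (Suc b)))"
    using power_associative[OF assms(2,3), of x] by (simp only: n_i) (simp only: i)
  also have "\<dots> = f (mult ((f ^^ (a + b)) (?pow (Suc a))) ((f ^^ (a + b)) (?pow (Suc b))))"
    by (simp add: funpow_morphism_mult[of f mult, OF morphism])
  also have "(f ^^ (a + b)) (?pow (Suc a)) = (f ^^ b) (P (Suc a))"
    by (simp only: power add.commute[of a b] funpow_add comp_apply)
  also have "(f ^^ (a + b)) (?pow (Suc b)) = (f ^^ a) (P (Suc b))"
    by (simp only: power funpow_add comp_apply)
  finally show ?thesis
    by (simp add: n_i) (simp add: i)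
qed

theorem corollary2p6:
  fixes scale :: "'k::field_char_0 \<Rightarrow> 'a::ab_group_add \<Rightarrow> 'a"
    and \<mu> :: "'a \<Rightarrow> 'a \<Rightarrow> 'a"
    and \<beta> :: "'a \<Rightarrow> 'a"
  assumes "power_associative_algebra scale \<mu>"
    and "algebra_morphism scale \<mu> scale \<mu> \<beta>"
  shows "multiplicative_hom_algebra scale (\<lambda>x y. \<beta> (\<mu> x y)) \<beta> \<and>
    hom_power_associative_algebra scale (\<lambda>x y. \<beta> (\<mu> x y)) \<beta>"
proof -
  interpret power_associative_algebra scale \<mu> by (fact assms(1))
  interpret morphism: algebra_morphism scale \<mu> scale \<mu> \<beta> by (fact assms(2))
  interpret twisted: hom_algebra scale "\<lambda>x y. \<beta> (\<mu> x y)" \<beta>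
    by (rule hom_algebra_twisted) (fact morphism.linear_morphism)
  have "multiplicative_hom_algebra scale (\<lambda>x y. \<beta> (\<mu> x y)) \<beta>"
    by unfold_locales (simp add: morphism.morphism_mult)
  moreover have "hom_power_associative_algebra scale (\<lambda>x y. \<beta> (\<mu> x y)) \<beta>"
    by unfold_locales (rule hom_power_associative_twisted[OF morphism.morphism_mult])
  ultimately show ?thesis ..
qed

end
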